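(* Let $K\subset\mathbb{R}^2$ be a compact convex set of area $F$ with boundary of class $\mathcal{C}^2$, having the origin as an interior point. Then $$\int_{G_i\cap K\neq\emptyset}dG_1\,dG_2=2\pi F+2\int_{P\notin K}(\omega-\sin\omega)\,dP.$$
   Context: For $P\notin K$, $\omega=\omega(P)\in(0,\pi)$ is the visual angle of $K$ from $P$, i.e. the angle between the two tangents from $P$ to the boundary of $K$ (the angle at $P$ of the sector with vertex $P$ containing $K$), and $dP$ is the area element of the plane. A line $G\subset\mathbb{R}^2$ not passing through the origin is given coordinates $(p,\varphi)$, $p>0$, $0\le\varphi<2\pi$, which are the polar coordinates of the point of $G$ at minimum distance from the origin (lines through the origin form a null set and are disregarded). $dG=dp\,d\varphi$, and ordered pairs of lines $(G_1,G_2)$, with coordinates $(p_i,\varphi_i)$, carry the measure $dG_1\,dG_2=dp_1\,d\varphi_1\,dp_2\,d\varphi_2$. The integral over $G_i\cap K\neq\emptyset$ is over all ordered pairs $(G_1,G_2)$ such that both $G_1$ and $G_2$ meet $K$. *)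

theory Defs
  imports "HOL-Analysis.Analysis"
begin

definition C2_differentiable_on :: "(real \<Rightarrow> 'a::real_normed_vector) \<Rightarrow> real set \<Rightarrow> bool"
  where "C2_differentiable_on f S \<longleftrightarrow>
    (\<exists>D. (\<forall>t\<in>S. (f has_vector_derivative D t) (at t)) \<and> D C1_differentiable_on S)"

text \<open>A set is a regular (embedded) curve of class \<open>C\<^sup>2\<close> if near each of its points it is the
  homeomorphic image of an open interval under a \<open>C\<^sup>2\<close> map with nowhere vanishing velocity.\<close>

definition C2_curve :: "'a::real_normed_vector set \<Rightarrow> bool"
  where "C2_curve S \<longleftrightarrow>
    (\<forall>x\<in>S. \<exists>U a b \<gamma> \<delta>. open U \<and> x \<in> U \<and> a < b \<and>
       homeomorphism {a<..<b} (S \<inter> U) \<gamma> \<delta> \<and>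
       C2_differentiable_on \<gamma> {a<..<b} \<and>
       (\<forall>t\<in>{a<..<b}. vector_derivative \<gamma> (at t) \<noteq> 0))"

definition tangent_vector :: "'a::real_normed_vector set \<Rightarrow> 'a \<Rightarrow> 'a \<Rightarrow> bool"
  where "tangent_vector S x v \<longleftrightarrow>
    (\<exists>\<gamma> e. 0 < e \<and> \<gamma> ` {-e<..<e} \<subseteq> S \<and> \<gamma> 0 = x \<and> (\<gamma> has_vector_derivative v) (at 0))"

text \<open>The points of contact of the tangents from \<open>P\<close> to the boundary of \<open>K\<close>.  A tangent may
  touch the boundary along a whole segment.\<close>

definition tangency_points :: "'a::real_normed_vector set \<Rightarrow> 'a \<Rightarrow> 'a set"
  where "tangency_points K P = {x \<in> frontier K. tangent_vector (frontier K) x (P - x)}"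

definition angle_between :: "'a::real_inner \<Rightarrow> 'a \<Rightarrow> real"
  where "angle_between u v = arccos ((u \<bullet> v) / (norm u * norm v))"

text \<open>The angle at \<open>P\<close> between the two tangents from \<open>P\<close> to the boundary of \<open>K\<close>.  Each tangent is
  taken as the ray from \<open>P\<close> through its contact points; non-collinearity says that \<open>x\<close> and \<open>y\<close> lie
  on different tangents.  As the rays point towards \<open>K\<close>, this is the angle of the sector
  containing \<open>K\<close> and not its supplement.  Only meaningful for \<open>P \<notin> K\<close>.\<close>

definition visual_angle :: "(real^2) set \<Rightarrow> real^2 \<Rightarrow> real"
  where "visual_angle K P =
    (THE \<omega>. \<exists>x\<in>tangency_points K P. \<exists>y\<in>tangency_points K P.
        \<not> collinear {P, x, y} \<and> \<omega> = angle_between (x - P) (y - P))"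

definition unit_dir :: "real \<Rightarrow> real^2"
  where "unit_dir \<phi> = vector [cos \<phi>, sin \<phi>]"

fun line_of_coords :: "real \<times> real \<Rightarrow> (real^2) set"
  where "line_of_coords (p, \<phi>) = {x. x \<bullet> unit_dir \<phi> = p}"

lemma line_of_coords_foot:
  assumes "p > 0"
  shows "p *\<^sub>R unit_dir \<phi> \<in> line_of_coords (p, \<phi>)"
    and "x \<in> line_of_coords (p, \<phi>) \<Longrightarrow> x \<noteq> p *\<^sub>R unit_dir \<phi>
           \<Longrightarrow> norm (p *\<^sub>R unit_dir \<phi>) < norm x"
proof -
  have u: "unit_dir \<phi> \<bullet> unit_dir \<phi> = 1"
    by (simp add: unit_dir_def inner_vec_def sum_2 flip: power2_eq_square)
  then show "p *\<^sub>R unit_dir \<phi> \<in> line_of_coords (p, \<phi>)"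
    by simp
  assume x: "x \<in> line_of_coords (p, \<phi>)" "x \<noteq> p *\<^sub>R unit_dir \<phi>"
  have "0 < (x - p *\<^sub>R unit_dir \<phi>) \<bullet> (x - p *\<^sub>R unit_dir \<phi>)"
    using x by simp
  also have "\<dots> = x \<bullet> x - (p *\<^sub>R unit_dir \<phi>) \<bullet> (p *\<^sub>R unit_dir \<phi>)"
    using x u by (simp add: inner_diff inner_commute)
  finally show "norm (p *\<^sub>R unit_dir \<phi>) < norm x"
    by (simp only: norm_lt diff_gt_0_iff_gt)
qed

definition lines_meeting :: "(real^2) set \<Rightarrow> (real \<times> real) set"
  where "lines_meeting K =
    {(p, \<phi>). 0 < p \<and> 0 \<le> \<phi> \<and> \<phi> < 2 * pi \<and> line_of_coords (p, \<phi>) \<inter> K \<noteq> {}}"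

end

theory Submission
  imports Defs
begin

text \<open>Writing \<open>L\<close> for the set of coordinates of lines that meet \<open>K\<close>, the left hand side of Crofton's
  formula is the measure of \<open>L \<times> L\<close>, that is, the square of the measure of \<open>L\<close>.  Almost every pair of
  lines has a unique intersection point \<open>P\<close>.  For fixed normal directions \<open>\<phi>\<close> and \<open>\<psi>\<close>, the signed
  distances of the two lines from the origin are linear functions of \<open>P\<close> with determinant
  \<open>sin (\<psi> - \<phi>)\<close>, so
  \<open>dG\<^sub>1 dG\<^sub>2 = \<bar>sin (\<phi> - \<psi>)\<bar> dP d\<phi> d\<psi>\<close> and Tonelli's theorem turns the measure of \<open>L \<times> L\<close> into the
  integral over \<open>P\<close> of a density, the integral of \<open>\<bar>sin (\<phi> - \<psi>)\<bar>\<close> over all pairs of lines through \<open>P\<close>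
  that meet \<open>K\<close> (lemma \<open>emeasure_lines_meeting_square\<close>).

  Since \<open>\<bar>sin\<bar>\<close> has period \<open>pi\<close>, only the unoriented directions of the lines through \<open>P\<close> matter
  (lemma \<open>nn_integral_lines_through_point\<close>), and those which meet \<open>K\<close> fill an arc: of length \<open>pi\<close> if
  \<open>P\<close> lies in \<open>K\<close>, and of length the visual angle \<open>\<omega>\<close> otherwise.  An arc of length \<open>\<omega>\<close> contributes
  \<open>2 (\<omega> - sin \<omega>)\<close> (lemma \<open>nn_integral_abs_sin_square\<close>), which is \<open>2 pi\<close> on \<open>K\<close> and yields the two terms
  of the formula.

  What remains is to recognise the length of the arc at an exterior point as the visual angle, which
  is described through tangent vectors of the boundary (lemma \<open>visual_angle_and_meeting_normals\<close>).  A
  tangent vector at a boundary point is orthogonal to each supporting normal there, and smoothness of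
  the boundary supplies the converse, that the supporting line is tangent.  So the tangents from \<open>P\<close>
  are its supporting lines, and these bound the arc.\<close>

section \<open>Lebesgue measure in linear coordinates of the plane\<close>

lemma vector_2_measurable [measurable]:
  "(\<lambda>(x, y). vector [x, y] :: real^2) \<in> borel_measurable borel"
proof -
  have "(\<lambda>(x, y). vector [x, y] :: real^2) = (\<lambda>z. fst z *\<^sub>R axis 1 1 + snd z *\<^sub>R axis 2 1)"
    by (auto simp: fun_eq_iff vec_eq_iff forall_2 axis_def)
  also have "\<dots> \<in> borel_measurable borel"
    by (intro borel_measurable_continuous_onI continuous_intros)
  finally show ?thesis .
qed

lemma lborel_real2_eq_distr:
  "(lborel :: (real^2) measure) = distr lborel borel (\<lambda>(x, y). vector [x, y])"
proof (rule lborel_eqI)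
  fix l u :: "real^2"
  assume le: "\<And>b. b \<in> Basis \<Longrightarrow> l \<bullet> b \<le> u \<bullet> b"
  have le2: "l $ i \<le> u $ i" for i
    using le[of "axis i 1"] by (simp add: inner_axis axis_in_Basis_iff)
  have "(\<lambda>(x, y). vector [x, y] :: real^2) -` box l u = box (l$1, l$2) (u$1, u$2)"
    by (auto simp: mem_box_cart forall_2 box_prod)
  then have "emeasure (distr lborel borel (\<lambda>(x, y). vector [x, y])) (box l u)
      = emeasure lborel (box (l$1, l$2) (u$1, u$2))"
    by (subst emeasure_distr) auto
  also have "\<dots> = (u$1 - l$1) * (u$2 - l$2)"
    using le2 by (subst emeasure_lborel_box) (auto simp: Basis_prod_def)
  also have "\<dots> = (\<Prod>b\<in>Basis. (u - l) \<bullet> b)"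
    by (simp add: Basis_vec_def UNION_singleton_eq_range prod.reindex inj_on_def axis_eq_axis inner_axis UNIV_2 mult.commute)
  finally show "emeasure (distr lborel borel (\<lambda>(x, y). vector [x, y])) (box l u) =
    (\<Prod>b\<in>Basis. (u - l) \<bullet> b)" .
qed auto

text \<open>The plane change of variables \<open>(p, q) = (a x + b y, c x + d y)\<close>, as two shears: with \<open>y\<close>
  held fixed, \<open>x\<close> is traded for \<open>p\<close> (factor \<open>a\<close>, whence the assumption \<open>a \<noteq> 0\<close>), and with \<open>p\<close> held
  fixed, \<open>y\<close> is traded for \<open>q\<close> (factor determinant over \<open>a\<close>).  Each step is an affine
  substitution on the line, and only the order of integration changes in between.\<close>
lemma nn_integral_linear_coords:
  fixes f :: "real \<Rightarrow> real \<Rightarrow> ennreal" and a b c d :: real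
  assumes f[measurable]: "case_prod f \<in> borel_measurable (borel \<Otimes>\<^sub>M borel)"
    and a: "a \<noteq> 0" and det: "a * d - b * c \<noteq> 0"
  shows "(\<integral>\<^sup>+p. \<integral>\<^sup>+q. f p q \<partial>lborel \<partial>lborel)
    = ennreal \<bar>a * d - b * c\<bar> *
      (\<integral>\<^sup>+P. f (a * P$1 + b * P$2) (c * P$1 + d * P$2) \<partial>(lborel :: (real^2) measure))"
proof -
  define D where "D = a * d - b * c"
  have D: "D \<noteq> 0" using det by (simp add: D_def)
  have "(\<integral>\<^sup>+P. f (a * P$1 + b * P$2) (c * P$1 + d * P$2) \<partial>(lborel :: (real^2) measure))
      = (\<integral>\<^sup>+z. f (a * fst z + b * snd z) (c * fst z + d * snd z) \<partial>lborel)"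
    by (subst lborel_real2_eq_distr, subst nn_integral_distr) (auto simp: case_prod_beta)
  also have "\<dots> = (\<integral>\<^sup>+y. \<integral>\<^sup>+x. f (a * x + b * y) (c * x + d * y) \<partial>lborel \<partial>lborel)"
    unfolding lborel_prod[symmetric]
    by (subst lborel_pair.nn_integral_snd[symmetric]) auto
  finally have 1: "(\<integral>\<^sup>+P. f (a * P$1 + b * P$2) (c * P$1 + d * P$2) \<partial>(lborel :: (real^2) measure)) = \<dots>" .
  have "ennreal \<bar>a\<bar> * (\<integral>\<^sup>+y. \<integral>\<^sup>+x. f (a * x + b * y) (c * x + d * y) \<partial>lborel \<partial>lborel)
      = (\<integral>\<^sup>+y. ennreal \<bar>a\<bar> * (\<integral>\<^sup>+x. f (a * x + b * y) (c * x + d * y) \<partial>lborel) \<partial>lborel)"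
    by (subst nn_integral_cmult) auto
  also have "\<dots> = (\<integral>\<^sup>+y. \<integral>\<^sup>+p. f p (c * p / a + D / a * y) \<partial>lborel \<partial>lborel)"
  proof (rule nn_integral_cong)
    fix y
    have *: "c * (b * y + a * x) / a + D / a * y = c * x + d * y" for x
      using a by (simp add: D_def field_simps)
    have "(\<integral>\<^sup>+p. f p (c * p / a + D / a * y) \<partial>lborel)
        = ennreal \<bar>a\<bar> * (\<integral>\<^sup>+x. f (b * y + a * x) (c * (b * y + a * x) / a + D / a * y) \<partial>lborel)"
      using a by (intro nn_integral_real_affine) auto
    then show "ennreal \<bar>a\<bar> * (\<integral>\<^sup>+x. f (a * x + b * y) (c * x + d * y) \<partial>lborel)
        = (\<integral>\<^sup>+p. f p (c * p / a + D / a * y) \<partial>lborel)"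
      by (simp only: *) (simp only: add.commute)
  qed
  also have "\<dots> = (\<integral>\<^sup>+p. \<integral>\<^sup>+y. f p (c * p / a + D / a * y) \<partial>lborel \<partial>lborel)"
    by (rule lborel_pair.Fubini') auto
  finally have 2: "ennreal \<bar>a\<bar> * (\<integral>\<^sup>+y. \<integral>\<^sup>+x. f (a * x + b * y) (c * x + d * y) \<partial>lborel \<partial>lborel)
     = \<dots>" .
  have "(\<integral>\<^sup>+p. \<integral>\<^sup>+q. f p q \<partial>lborel \<partial>lborel)
      = (\<integral>\<^sup>+p. ennreal \<bar>D / a\<bar> * (\<integral>\<^sup>+y. f p (c * p / a + D / a * y) \<partial>lborel) \<partial>lborel)"
    using a D by (intro nn_integral_cong nn_integral_real_affine) auto
  also have "\<dots> = ennreal \<bar>D / a\<bar> * (\<integral>\<^sup>+p. \<integral>\<^sup>+y. f p (c * p / a + D / a * y) \<partial>lborel \<partial>lborel)"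
    by (subst nn_integral_cmult) auto
  also have "\<dots> = ennreal (\<bar>D / a\<bar> * \<bar>a\<bar>) * (\<integral>\<^sup>+y. \<integral>\<^sup>+x. f (a * x + b * y) (c * x + d * y) \<partial>lborel \<partial>lborel)"
    unfolding 2[symmetric] by (subst ennreal_mult) (auto simp: mult.assoc)
  finally show ?thesis using a by (simp add: 1 D_def)
qed

section \<open>Integrals over angles\<close>

lemma nn_integral_abs_sin_Icc:
  fixes s t x :: real
  assumes "s \<le> x" "x \<le> t" "t - s \<le> pi"
  shows "(\<integral>\<^sup>+y\<in>{s..t}. ennreal \<bar>sin (x - y)\<bar> \<partial>lborel) = ennreal (2 - cos (x - s) - cos (t - x))"
proof -
  have A: "(\<integral>\<^sup>+y\<in>{s..x}. ennreal (sin (x - y)) \<partial>lborel) = ennreal (1 - cos (x - s))"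
  proof -
    have "has_bochner_integral lborel (\<lambda>y. sin (x - y) * indicator {s..x} y) (cos (x - x) - cos (x - s))"
      using assms(1) by (intro has_bochner_integral_FTC_Icc_real) (auto intro!: derivative_eq_intros)
    moreover have "0 \<le> sin (x - y) * indicator {s..x} y" for y
      using assms by (auto simp: indicator_def sin_ge_zero)
    ultimately show ?thesis
      by (simp add: has_bochner_integral_iff nn_integral_eq_integral nn_integral_set_ennreal)
  qed
  have B: "(\<integral>\<^sup>+y\<in>{x..t}. ennreal (sin (y - x)) \<partial>lborel) = ennreal (1 - cos (t - x))"
  proof -
    have "has_bochner_integral lborel (\<lambda>y. sin (y - x) * indicator {x..t} y) (- cos (t - x) - (- cos (x - x)))"
      using assms(2) by (intro has_bochner_integral_FTC_Icc_real) (auto intro!: derivative_eq_intros)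
    moreover have "0 \<le> sin (y - x) * indicator {x..t} y" for y
      using assms by (auto simp: indicator_def sin_ge_zero)
    ultimately show ?thesis
      by (simp add: has_bochner_integral_iff nn_integral_eq_integral nn_integral_set_ennreal)
  qed
  have "(\<integral>\<^sup>+y\<in>{s..t}. ennreal \<bar>sin (x - y)\<bar> \<partial>lborel)
      = (\<integral>\<^sup>+y. ennreal (sin (x - y)) * indicator {s..x} y + ennreal (sin (y - x)) * indicator {x..t} y \<partial>lborel)"
  proof (rule nn_integral_cong)
    fix y
    have "\<bar>sin (x - y)\<bar> = sin (x - y)" if "s \<le> y" "y \<le> x"
      using assms that by (auto simp: sin_ge_zero)
    moreover have "\<bar>sin (x - y)\<bar> = sin (y - x)" if "x \<le> y" "y \<le> t"
      using assms that sin_ge_zero[of "y - x"] sin_minus[of "y - x"] by auto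
    ultimately show "ennreal \<bar>sin (x - y)\<bar> * indicator {s..t} y
      = ennreal (sin (x - y)) * indicator {s..x} y + ennreal (sin (y - x)) * indicator {x..t} y"
      using assms by (auto simp: indicator_def)
  qed
  also have "\<dots> = ennreal (1 - cos (x - s)) + ennreal (1 - cos (t - x))"
    by (subst nn_integral_add) (auto simp: A B)
  also have "\<dots> = ennreal (2 - cos (x - s) - cos (t - x))"
    by (subst ennreal_plus[symmetric]) (auto simp: algebra_simps)
  finally show ?thesis .
qed

text \<open>The source of \<open>\<omega> - sin \<omega>\<close>: the function \<open>\<bar>sin\<bar>\<close> of the angle between two directions, integrated
  over all pairs of directions in an arc of length \<open>\<omega>\<close>.\<close>
lemma nn_integral_abs_sin_square:
  fixes s t :: real
  assumes "s \<le> t" "t - s \<le> pi"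
  shows "(\<integral>\<^sup>+x\<in>{s..t}. (\<integral>\<^sup>+y\<in>{s..t}. ennreal \<bar>sin (x - y)\<bar> \<partial>lborel) \<partial>lborel)
    = ennreal (2 * (t - s) - 2 * sin (t - s))"
proof -
  let ?F = "\<lambda>x. 2 * x - sin (x - s) + sin (t - x)"
  have "(\<integral>\<^sup>+x\<in>{s..t}. (\<integral>\<^sup>+y\<in>{s..t}. ennreal \<bar>sin (x - y)\<bar> \<partial>lborel) \<partial>lborel)
      = (\<integral>\<^sup>+x\<in>{s..t}. ennreal (2 - cos (x - s) - cos (t - x)) \<partial>lborel)"
    using assms by (intro set_nn_integral_cong) (auto simp: nn_integral_abs_sin_Icc)
  also have "\<dots> = ennreal (?F t - ?F s)"
  proof -
    have "has_bochner_integral lborel (\<lambda>x. (2 - cos (x - s) - cos (t - x)) * indicator {s..t} x) (?F t - ?F s)"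
      using assms(1) by (intro has_bochner_integral_FTC_Icc_real) (auto intro!: derivative_eq_intros)
    moreover have "0 \<le> (2 - cos (x - s) - cos (t - x)) * indicator {s..t} x" for x
      using cos_le_one[of "x - s"] cos_le_one[of "t - x"] unfolding indicator_def by (auto simp del: cos_le_one)
    ultimately show ?thesis
      by (simp add: has_bochner_integral_iff nn_integral_eq_integral nn_integral_set_ennreal)
  qed
  finally show ?thesis by simp
qed

lemma nn_integral_periodic_window:
  fixes f :: "real \<Rightarrow> ennreal"
  assumes [measurable]: "f \<in> borel_measurable borel"
    and T: "0 < T" and per: "\<And>x. f (x + T) = f x"
  shows "(\<integral>\<^sup>+x\<in>{a..<a+T}. f x \<partial>lborel) = (\<integral>\<^sup>+x\<in>{b..<b+T}. f x \<partial>lborel)"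
proof -
  define W where "W c = (\<integral>\<^sup>+x\<in>{c..<c+T}. f x \<partial>lborel)" for c
  have split: "(\<integral>\<^sup>+x\<in>{c..<e}. f x \<partial>lborel)
      = (\<integral>\<^sup>+x\<in>{c..<d}. f x \<partial>lborel) + (\<integral>\<^sup>+x\<in>{d..<e}. f x \<partial>lborel)" if "c \<le> d" "d \<le> e" for c d e
    by (subst nn_integral_add[symmetric]) (use that in \<open>auto simp: indicator_def intro!: nn_integral_cong\<close>)
  have shift: "(\<integral>\<^sup>+x\<in>{c+T..<d+T}. f x \<partial>lborel) = (\<integral>\<^sup>+x\<in>{c..<d}. f x \<partial>lborel)" for c d
    using nn_integral_real_affine[of "\<lambda>x. f x * indicator {c+T..<d+T} x" 1 T]
    by (simp add: per add.commute[of T] indicator_def)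
  have small: "W (c + d) = W c" if "0 \<le> d" "d \<le> T" for c d
    unfolding W_def using that shift[of c "c + d"] split[of c "c + d" "c + T"] split[of "c + d" "c + T" "c + d + T"]
    by (simp add: add.commute)
  have le: "W a = W b" if "a \<le> b" for a b
  proof -
    \<comment> \<open>The identity for steps of length at most one period reaches \<open>b\<close> after \<open>n\<close> equal steps.\<close>
    obtain n where n: "(b - a) / T < real n" using reals_Archimedean2 by blast
    define d where "d = (b - a) / real n"
    have "0 \<le> (b - a) / T" using T that by simp
    with n have n0: "0 < real n" by linarith
    then have d: "0 \<le> d" "d \<le> T" "a + real n * d = b"
      using n T that by (auto simp: d_def field_simps)
    have "W (a + real k * d) = W a" for k
    proof (induction k)
      case (Suc k)
      then show ?case using small[OF d(1,2), of "a + real k * d"] by (simp add: algebra_simps)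
    qed simp
    from this[of n] show ?thesis by (simp add: d)
  qed
  have "W a = W b" using le by (metis linear)
  then show ?thesis by (simp only: W_def)
qed

section \<open>Unit directions\<close>

lemma inner_unit_dir: "x \<bullet> unit_dir \<phi> = x$1 * cos \<phi> + x$2 * sin \<phi>"
  by (simp add: unit_dir_def inner_vec_def sum_2)

lemma continuous_on_unit_dir [continuous_intros]:
  fixes f :: "'a::t2_space \<Rightarrow> real"
  assumes "continuous_on S f"
  shows "continuous_on S (\<lambda>x. unit_dir (f x))"
proof -
  have "unit_dir \<phi> = cos \<phi> *\<^sub>R axis 1 1 + sin \<phi> *\<^sub>R axis 2 1" for \<phi>
    by (auto simp: unit_dir_def vec_eq_iff forall_2 axis_def)
  then show ?thesis
    using assms by (auto intro!: continuous_intros)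
qed

lemma unit_dir_measurable [measurable]: "unit_dir \<in> borel_measurable borel"
  by (intro borel_measurable_continuous_onI continuous_intros)

lemma unit_dir_pi [simp]: "unit_dir (\<phi> + pi) = - unit_dir \<phi>"
  by (simp add: unit_dir_def vec_eq_iff forall_2)

lemma inner_unit_dir_unit_dir: "unit_dir \<phi> \<bullet> unit_dir \<psi> = cos (\<phi> - \<psi>)"
  by (simp add: inner_unit_dir cos_diff) (simp add: unit_dir_def)

lemma norm_unit_dir [simp]: "norm (unit_dir \<phi>) = 1"
  by (simp add: norm_eq_sqrt_inner inner_unit_dir_unit_dir)

lemma unit_dir_nonzero [simp]: "unit_dir \<phi> \<noteq> 0"
  using norm_unit_dir[of \<phi>] by (metis norm_zero zero_neq_one)

lemma polar_decomposition:
  fixes x :: "real^2"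
  obtains \<phi> where "x = norm x *\<^sub>R unit_dir \<phi>"
proof (cases "x = 0")
  case False
  have "(x$1 / norm x)\<^sup>2 + (x$2 / norm x)\<^sup>2 = 1"
  proof -
    have "(norm x)\<^sup>2 = (x$1)\<^sup>2 + (x$2)\<^sup>2"
      by (simp add: norm_vec_def L2_set_def sum_2)
    then show ?thesis
      using False by (metis add_divide_distrib divide_self norm_eq_zero power_divide power_not_zero)
  qed
  then obtain \<phi> where "x$1 / norm x = cos \<phi>" "x$2 / norm x = sin \<phi>"
    by (rule sincos_total_2pi)
  then have "x$1 = norm x * cos \<phi>" "x$2 = norm x * sin \<phi>"
    using False by (simp_all add: divide_eq_eq mult.commute)
  then have "x = norm x *\<^sub>R unit_dir \<phi>"
    unfolding vec_eq_iff forall_2 by (simp add: unit_dir_def)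
  then show ?thesis by (rule that)
qed (simp add: that)

text \<open>Both normals of a line through \<open>P\<close> count, so that this set is invariant under adding \<open>pi\<close> and may be observed through any window of length
  \<open>pi\<close>.\<close>
definition meeting_normals :: "(real^2) set \<Rightarrow> real^2 \<Rightarrow> real set"
  where "meeting_normals K P = {\<phi>. \<exists>x\<in>K. x \<bullet> unit_dir \<phi> = P \<bullet> unit_dir \<phi>}"

section \<open>The measure of pairs of lines, sorted by their intersection point\<close>

text \<open>The density, with respect to the intersection point, of the measure on ordered pairs of lines that
  meet \<open>K\<close>: the factor \<open>\<bar>sin (\<phi> - \<psi>)\<bar>\<close> is the Jacobian of \<open>P \<mapsto> (P \<bullet> unit_dir \<phi>, P \<bullet> unit_dir \<psi>)\<close>,
  which sends a point to the signed distances from the origin of the two lines through it with normals \<open>\<phi>\<close>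
  and \<open>\<psi>\<close>.\<close>

definition crossing_density :: "(real^2) set \<Rightarrow> real^2 \<Rightarrow> ennreal"
  where "crossing_density K P = (\<integral>\<^sup>+\<phi>. \<integral>\<^sup>+\<psi>. ennreal \<bar>sin (\<phi> - \<psi>)\<bar> *
    (indicator (lines_meeting K) (P \<bullet> unit_dir \<phi>, \<phi>) * indicator (lines_meeting K) (P \<bullet> unit_dir \<psi>, \<psi>))
    \<partial>lborel \<partial>lborel)"

lemma mem_lines_meeting:
  "(p, \<phi>) \<in> lines_meeting K \<longleftrightarrow> 0 < p \<and> 0 \<le> \<phi> \<and> \<phi> < 2 * pi \<and> (\<exists>x\<in>K. x \<bullet> unit_dir \<phi> = p)"
  by (auto simp: lines_meeting_def)

lemma mem_lines_meeting_through:
  "(P \<bullet> unit_dir \<phi>, \<phi>) \<in> lines_meeting K \<longleftrightarrow>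
    0 < P \<bullet> unit_dir \<phi> \<and> \<phi> \<in> {0..<2 * pi} \<and> \<phi> \<in> meeting_normals K P"
  by (auto simp: mem_lines_meeting meeting_normals_def)

lemma lines_meeting_borel:
  assumes "compact K"
  shows "lines_meeting K \<in> sets borel"
proof -
  have "closed {z. \<exists>x. x \<in> K \<and> (x, z) \<in> {w. fst w \<bullet> unit_dir (snd (snd w)) = fst (snd w)}}"
    by (rule closed_compact_projection[OF assms])
       (auto intro!: closed_Collect_eq continuous_intros)
  moreover have "{0<..} \<times> {0..<2 * pi} \<in> sets (borel :: (real \<times> real) measure)"
    by (intro borel_Times) auto
  moreover have "lines_meeting K = {z. \<exists>x. x \<in> K \<and> (x, z) \<in> {w. fst w \<bullet> unit_dir (snd (snd w)) = fst (snd w)}}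
      \<inter> {0<..} \<times> {0..<2 * pi}"
    by (auto simp: mem_lines_meeting)
  ultimately show ?thesis by (simp add: borel_closed sets.Int)
qed

lemma emeasure_lines_meeting_finite:
  assumes "compact K"
  shows "emeasure lborel (lines_meeting K) < \<infinity>"
proof -
  obtain B where B: "\<And>x. x \<in> K \<Longrightarrow> norm x \<le> B"
    using compact_imp_bounded[OF assms] bounded_iff by metis
  have "p \<le> B" if "(p, \<phi>) \<in> lines_meeting K" for p \<phi>
  proof -
    obtain x where "x \<in> K" "x \<bullet> unit_dir \<phi> = p" using \<open>_ \<in> lines_meeting K\<close> by (auto simp: mem_lines_meeting)
    then show ?thesis using norm_cauchy_schwarz[of x "unit_dir \<phi>"] B[of x] by simp
  qed
  then have "lines_meeting K \<subseteq> cbox (0, 0) (B, 2 * pi)"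
    by (force simp: mem_lines_meeting)
  then have "emeasure lborel (lines_meeting K) \<le> emeasure lborel (cbox (0::real, 0::real) (B, 2 * pi))"
    by (intro emeasure_mono) auto
  also have "\<dots> < \<infinity>"
    by (rule emeasure_lborel_cbox_finite)
  finally show ?thesis .
qed

lemma meeting_normals_joint_measurable:
  assumes "compact K"
  shows "Measurable.pred (borel \<Otimes>\<^sub>M borel) (\<lambda>(P, \<phi>). \<phi> \<in> meeting_normals K P)"
proof -
  have "closed {z. \<exists>x. x \<in> K \<and> (x, z) \<in> {w. fst w \<bullet> unit_dir (snd (snd w)) = fst (snd w) \<bullet> unit_dir (snd (snd w))}}"
    by (rule closed_compact_projection[OF assms])
       (auto intro!: closed_Collect_eq continuous_intros)
  moreover have "{z. \<exists>x. x \<in> K \<and> (x, z) \<in> {w. fst w \<bullet> unit_dir (snd (snd w)) = fst (snd w) \<bullet> unit_dir (snd (snd w))}}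
     = {z. case z of (P, \<phi>) \<Rightarrow> \<phi> \<in> meeting_normals K P}"
    by (auto simp: meeting_normals_def)
  ultimately show ?thesis by (simp add: borel_prod pred_def borel_closed)
qed

lemma AE_neq_zero_if_countable:
  fixes f :: "real \<Rightarrow> real"
  assumes "countable {x. f x = 0}"
  shows "AE x in lborel. f x \<noteq> 0"
  using countable_imp_null_set_lborel[OF assms] by (auto intro: AE_I')

lemma AE_sin_neq_zero: "AE x in lborel. sin (x + c :: real) \<noteq> 0"
proof (rule AE_neq_zero_if_countable)
  have "{x. sin (x + c) = 0} \<subseteq> (\<lambda>i::int. real_of_int i * pi - c) ` UNIV"
    by (auto simp: sin_zero_iff_int2 image_iff algebra_simps)
  then show "countable {x. sin (x + c) = 0}"
    by (rule countable_subset) auto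
qed

text \<open>For fixed normals \<open>\<phi>\<close> and \<open>\<psi>\<close> the two distances are linear coordinates of the intersection point,
  so the integral over pairs of lines turns into an integral over points once the orders of
  integration are exchanged.\<close>
lemma emeasure_lines_meeting_square:
  assumes "compact K"
  shows "emeasure lborel (lines_meeting K) * emeasure lborel (lines_meeting K)
    = (\<integral>\<^sup>+P. crossing_density K P \<partial>lborel)"
proof -
  define I :: "real \<Rightarrow> real \<Rightarrow> ennreal" where "I p \<phi> = indicator (lines_meeting K) (p, \<phi>)" for p \<phi>
  have "lines_meeting K \<in> sets (borel \<Otimes>\<^sub>M borel)"
    using lines_meeting_borel[OF assms] unfolding borel_prod .
  then have [measurable]: "case_prod I \<in> borel_measurable (borel \<Otimes>\<^sub>M borel)"
    unfolding I_def by (simp add: case_prod_beta)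
  have L: "emeasure lborel (lines_meeting K) = (\<integral>\<^sup>+\<phi>. \<integral>\<^sup>+p. I p \<phi> \<partial>lborel \<partial>lborel)"
  proof -
    have "(\<integral>\<^sup>+\<phi>. \<integral>\<^sup>+p. I p \<phi> \<partial>lborel \<partial>lborel) = (\<integral>\<^sup>+z. case_prod I z \<partial>(lborel \<Otimes>\<^sub>M lborel))"
      by (subst lborel_pair.nn_integral_snd[symmetric]) auto
    also have "\<dots> = (\<integral>\<^sup>+z. indicator (lines_meeting K) z \<partial>lborel)"
      by (simp add: lborel_prod I_def case_prod_beta)
    finally show ?thesis using lines_meeting_borel[OF assms] by simp
  qed
  have "emeasure lborel (lines_meeting K) * emeasure lborel (lines_meeting K)
      = (\<integral>\<^sup>+\<phi>. \<integral>\<^sup>+\<psi>. (\<integral>\<^sup>+p. I p \<phi> \<partial>lborel) * (\<integral>\<^sup>+q. I q \<psi> \<partial>lborel) \<partial>lborel \<partial>lborel)"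
    by (simp add: L nn_integral_cmult nn_integral_multc)
  also have "\<dots> = (\<integral>\<^sup>+\<phi>. \<integral>\<^sup>+\<psi>. (\<integral>\<^sup>+p. \<integral>\<^sup>+q. I p \<phi> * I q \<psi> \<partial>lborel \<partial>lborel) \<partial>lborel \<partial>lborel)"
    by (simp add: nn_integral_cmult nn_integral_multc)
  also have "\<dots> = (\<integral>\<^sup>+\<phi>. \<integral>\<^sup>+\<psi>. ennreal \<bar>sin (\<phi> - \<psi>)\<bar> *
      (\<integral>\<^sup>+P. I (P \<bullet> unit_dir \<phi>) \<phi> * I (P \<bullet> unit_dir \<psi>) \<psi> \<partial>lborel) \<partial>lborel \<partial>lborel)"
  \<comment> \<open>Discarded are the null sets of \<open>\<phi>\<close> where the first shear degenerates and of \<open>\<psi>\<close> where the two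
    lines are parallel.\<close>
  proof (rule nn_integral_cong_AE)
    show "AE \<phi> in lborel. (\<integral>\<^sup>+\<psi>. (\<integral>\<^sup>+p. \<integral>\<^sup>+q. I p \<phi> * I q \<psi> \<partial>lborel \<partial>lborel) \<partial>lborel)
      = (\<integral>\<^sup>+\<psi>. ennreal \<bar>sin (\<phi> - \<psi>)\<bar> *
          (\<integral>\<^sup>+P. I (P \<bullet> unit_dir \<phi>) \<phi> * I (P \<bullet> unit_dir \<psi>) \<psi> \<partial>lborel) \<partial>lborel)"
      using AE_sin_neq_zero[of "pi / 2"]
    proof eventually_elim
      case (elim \<phi>)
      then have c: "cos \<phi> \<noteq> 0" by (simp add: sin_add)
      show ?case
      proof (rule nn_integral_cong_AE)
        show "AE \<psi> in lborel. (\<integral>\<^sup>+p. \<integral>\<^sup>+q. I p \<phi> * I q \<psi> \<partial>lborel \<partial>lborel)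
          = ennreal \<bar>sin (\<phi> - \<psi>)\<bar> *
              (\<integral>\<^sup>+P. I (P \<bullet> unit_dir \<phi>) \<phi> * I (P \<bullet> unit_dir \<psi>) \<psi> \<partial>lborel)"
          using AE_sin_neq_zero[of "- \<phi>"]
        proof eventually_elim
          case (elim \<psi>)
          have *: "cos \<phi> * sin \<psi> - sin \<phi> * cos \<psi> = sin (\<psi> + - \<phi>)"
            by (simp add: sin_diff)
          have "(\<integral>\<^sup>+p. \<integral>\<^sup>+q. I p \<phi> * I q \<psi> \<partial>lborel \<partial>lborel)
            = ennreal \<bar>cos \<phi> * sin \<psi> - sin \<phi> * cos \<psi>\<bar> * (\<integral>\<^sup>+P.
               I (cos \<phi> * P$1 + sin \<phi> * P$2) \<phi> * I (cos \<psi> * P$1 + sin \<psi> * P$2) \<psi> \<partial>(lborel :: (real^2) measure))"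
            using elim c by (intro nn_integral_linear_coords) (auto simp: *)
          then show ?case
            unfolding * using sin_minus[of "\<phi> - \<psi>"] by (simp add: inner_unit_dir mult.commute)
        qed
      qed
    qed
  qed
  also have "\<dots> = (\<integral>\<^sup>+\<phi>. \<integral>\<^sup>+\<psi>. \<integral>\<^sup>+P. ennreal \<bar>sin (\<phi> - \<psi>)\<bar> *
      (I (P \<bullet> unit_dir \<phi>) \<phi> * I (P \<bullet> unit_dir \<psi>) \<psi>) \<partial>lborel \<partial>lborel \<partial>lborel)"
    by (simp add: nn_integral_cmult)
  also have "\<dots> = (\<integral>\<^sup>+\<phi>. \<integral>\<^sup>+P. \<integral>\<^sup>+\<psi>. ennreal \<bar>sin (\<phi> - \<psi>)\<bar> *
      (I (P \<bullet> unit_dir \<phi>) \<phi> * I (P \<bullet> unit_dir \<psi>) \<psi>) \<partial>lborel \<partial>lborel \<partial>lborel)"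
    by (intro nn_integral_cong lborel_pair.Fubini') measurable
  also have "\<dots> = (\<integral>\<^sup>+P. \<integral>\<^sup>+\<phi>. \<integral>\<^sup>+\<psi>. ennreal \<bar>sin (\<phi> - \<psi>)\<bar> *
      (I (P \<bullet> unit_dir \<phi>) \<phi> * I (P \<bullet> unit_dir \<psi>) \<psi>) \<partial>lborel \<partial>lborel \<partial>lborel)"
    by (intro lborel_pair.Fubini') measurable
  finally show ?thesis by (simp add: I_def crossing_density_def)
qed

lemma crossing_density_measurable:
  assumes "compact K"
  shows "crossing_density K \<in> borel_measurable borel"
proof -
  define I :: "real \<Rightarrow> real \<Rightarrow> ennreal" where "I p \<phi> = indicator (lines_meeting K) (p, \<phi>)" for p \<phi>
  have "lines_meeting K \<in> sets (borel \<Otimes>\<^sub>M borel)"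
    using lines_meeting_borel[OF assms] unfolding borel_prod .
  then have [measurable]: "case_prod I \<in> borel_measurable (borel \<Otimes>\<^sub>M borel)"
    unfolding I_def by (simp add: case_prod_beta)
  have "crossing_density K = (\<lambda>P. \<integral>\<^sup>+\<phi>. \<integral>\<^sup>+\<psi>. ennreal \<bar>sin (\<phi> - \<psi>)\<bar> *
      (I (P \<bullet> unit_dir \<phi>) \<phi> * I (P \<bullet> unit_dir \<psi>) \<psi>) \<partial>lborel \<partial>lborel)"
    by (simp add: fun_eq_iff crossing_density_def I_def)
  also have "\<dots> \<in> borel_measurable borel"
    by measurable
  finally show ?thesis .
qed

text \<open>A line that avoids the origin has exactly one of its two normals \<open>\<phi>\<close>, \<open>\<phi> + pi\<close> on the side
  \<open>0 < P \<bullet> unit_dir \<phi>\<close>.  Folding \<open>[0, 2 pi)\<close> onto \<open>[0, pi)\<close> therefore removes this sign condition at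
  the cost of the single direction in which the line runs from \<open>P\<close> to the origin, and periodicity then
  moves the window to wherever it is convenient.\<close>
lemma nn_integral_lines_through_point:
  fixes f :: "real \<Rightarrow> ennreal"
  assumes "compact K" and [measurable]: "f \<in> borel_measurable borel"
    and per: "\<And>\<phi>. f (\<phi> + pi) = f \<phi>" and "P \<noteq> 0"
  shows "(\<integral>\<^sup>+\<phi>. f \<phi> * indicator (lines_meeting K) (P \<bullet> unit_dir \<phi>, \<phi>) \<partial>lborel)
    = (\<integral>\<^sup>+\<phi>\<in>{c..<c+pi} \<inter> meeting_normals K P. f \<phi> \<partial>lborel)"
proof -
  obtain \<alpha> where \<alpha>: "P = norm P *\<^sub>R unit_dir \<alpha>" by (rule polar_decomposition)
  have [measurable]: "Measurable.pred borel (\<lambda>\<phi>. \<phi> \<in> meeting_normals K P)"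
    using measurable_compose[OF measurable_Pair1' meeting_normals_joint_measurable[OF assms(1)], of P]
    by simp
  define g where "g \<phi> = f \<phi> * indicator (meeting_normals K P) \<phi>" for \<phi>
  have [measurable]: "g \<in> borel_measurable borel"
    unfolding g_def indicator_def by measurable
  have g_per: "g (\<phi> + pi) = g \<phi>" for \<phi>
    by (simp add: g_def per indicator_def meeting_normals_def)
  have neq: "AE \<phi> in lborel. P \<bullet> unit_dir \<phi> \<noteq> 0"
  proof -
    have "P \<bullet> unit_dir \<phi> = norm P * sin (\<phi> + (pi / 2 - \<alpha>))" for \<phi>
      by (subst \<alpha>) (simp add: inner_unit_dir_unit_dir sin_add cos_diff sin_diff cos_add)
    with AE_sin_neq_zero[of "pi / 2 - \<alpha>"] \<open>P \<noteq> 0\<close> show ?thesis by simp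
  qed
  have "(\<integral>\<^sup>+\<phi>. f \<phi> * indicator (lines_meeting K) (P \<bullet> unit_dir \<phi>, \<phi>) \<partial>lborel)
     = (\<integral>\<^sup>+\<phi>. g \<phi> * indicator {\<phi>. 0 < P \<bullet> unit_dir \<phi>} \<phi> * indicator {0..<pi} \<phi>
          + g \<phi> * indicator {\<phi>. 0 < P \<bullet> unit_dir \<phi>} \<phi> * indicator {pi..<2*pi} \<phi> \<partial>lborel)"
    by (intro nn_integral_cong) (auto simp: g_def indicator_def mem_lines_meeting_through)
  also have "\<dots> = (\<integral>\<^sup>+\<phi>. g \<phi> * indicator {\<phi>. 0 < P \<bullet> unit_dir \<phi>} \<phi> * indicator {0..<pi} \<phi> \<partial>lborel)
     + (\<integral>\<^sup>+\<phi>. g \<phi> * indicator {\<phi>. 0 < P \<bullet> unit_dir \<phi>} \<phi> * indicator {pi..<2*pi} \<phi> \<partial>lborel)"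
    by (rule nn_integral_add) auto
  also have "(\<integral>\<^sup>+\<phi>. g \<phi> * indicator {\<phi>. 0 < P \<bullet> unit_dir \<phi>} \<phi> * indicator {pi..<2*pi} \<phi> \<partial>lborel)
     = (\<integral>\<^sup>+\<phi>. g \<phi> * indicator {\<phi>. P \<bullet> unit_dir \<phi> < 0} \<phi> * indicator {0..<pi} \<phi> \<partial>lborel)"
    using nn_integral_real_affine[of "\<lambda>\<phi>. g \<phi> * indicator {\<phi>. 0 < P \<bullet> unit_dir \<phi>} \<phi> * indicator {pi..<2*pi} \<phi>" 1 pi]
    by (simp add: add.commute[of pi] g_per indicator_def)
  also have "(\<integral>\<^sup>+\<phi>. g \<phi> * indicator {\<phi>. 0 < P \<bullet> unit_dir \<phi>} \<phi> * indicator {0..<pi} \<phi> \<partial>lborel) + \<dots>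
     = (\<integral>\<^sup>+\<phi>. g \<phi> * indicator {\<phi>. 0 < P \<bullet> unit_dir \<phi>} \<phi> * indicator {0..<pi} \<phi>
          + g \<phi> * indicator {\<phi>. P \<bullet> unit_dir \<phi> < 0} \<phi> * indicator {0..<pi} \<phi> \<partial>lborel)"
    by (rule nn_integral_add[symmetric]) auto
  also have "\<dots> = (\<integral>\<^sup>+\<phi>\<in>{0..<0+pi}. g \<phi> \<partial>lborel)"
    using neq by (intro nn_integral_cong_AE) (auto simp: indicator_def)
  also have "\<dots> = (\<integral>\<^sup>+\<phi>\<in>{c..<c+pi}. g \<phi> \<partial>lborel)"
    by (rule nn_integral_periodic_window) (auto simp: g_per)
  also have "\<dots> = (\<integral>\<^sup>+\<phi>\<in>{c..<c+pi} \<inter> meeting_normals K P. f \<phi> \<partial>lborel)"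
    by (intro nn_integral_cong) (auto simp: g_def indicator_def)
  finally show ?thesis .
qed

text \<open>The arc is fixed only up to its end points, so that the half-open window of all directions, which
  occurs at the points of \<open>K\<close>, counts as an arc of length \<open>pi\<close>.\<close>
lemma crossing_density_eq:
  assumes "compact K" "P \<noteq> 0"
    and "0 \<le> \<omega>" "\<omega> \<le> pi"
    and M: "{c..<c+pi} \<inter> meeting_normals K P \<subseteq> {s..s+\<omega>}"
      "{s<..<s+\<omega>} \<subseteq> {c..<c+pi} \<inter> meeting_normals K P"
  shows "crossing_density K P = ennreal (2 * (\<omega> - sin \<omega>))"
proof -
  let ?M = "{c..<c+pi} \<inter> meeting_normals K P"
  let ?I = "\<lambda>\<phi>. indicator (lines_meeting K) (P \<bullet> unit_dir \<phi>, \<phi>) :: ennreal"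
  have "lines_meeting K \<in> sets (borel \<Otimes>\<^sub>M borel)"
    using lines_meeting_borel[OF assms(1)] unfolding borel_prod .
  then have [measurable]: "?I \<in> borel_measurable borel"
    by measurable
  have ae: "(\<integral>\<^sup>+\<phi>\<in>?M. f \<phi> \<partial>lborel) = (\<integral>\<^sup>+\<phi>\<in>{s..s+\<omega>}. f \<phi> \<partial>lborel)" for f
  proof (rule nn_integral_cong_AE)
    have "AE \<phi> in lborel. \<phi> \<noteq> s" "AE \<phi> in lborel. \<phi> \<noteq> s + \<omega>"
      by (rule AE_lborel_singleton)+
    then show "AE \<phi> in lborel. f \<phi> * indicator ?M \<phi> = f \<phi> * indicator {s..s+\<omega>} \<phi>"
    proof eventually_elim
      case (elim \<phi>)
      then have "\<phi> \<in> ?M \<longleftrightarrow> \<phi> \<in> {s..s+\<omega>}"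
      proof -
        have "\<phi> \<in> {s<..<s+\<omega>}" if "\<phi> \<in> {s..s+\<omega>}"
          using elim that by simp
        then show ?thesis using M by blast
      qed
      then show ?case by (simp add: indicator_def)
    qed
  qed
  have abs_sin: "\<bar>sin (x + pi - y)\<bar> = \<bar>sin (x - y)\<bar>" "\<bar>sin (x - (y + pi))\<bar> = \<bar>sin (x - y)\<bar>" for x y :: real
  proof -
    have "x + pi - y = x - y + pi" "x - y = x - (y + pi) + pi" by simp_all
    then show "\<bar>sin (x + pi - y)\<bar> = \<bar>sin (x - y)\<bar>" "\<bar>sin (x - (y + pi))\<bar> = \<bar>sin (x - y)\<bar>"
      by (metis sin_periodic_pi abs_minus_cancel)+
  qed
  have window: "(\<integral>\<^sup>+\<phi>. f \<phi> * ?I \<phi> \<partial>lborel) = (\<integral>\<^sup>+\<phi>\<in>{s..s+\<omega>}. f \<phi> \<partial>lborel)"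
    if "f \<in> borel_measurable borel" "\<And>\<phi>. f (\<phi> + pi) = f \<phi>" for f
    using nn_integral_lines_through_point[OF assms(1) that assms(2), of c] by (simp only: ae)
  have "(\<integral>\<^sup>+\<phi>. \<integral>\<^sup>+\<psi>. ennreal \<bar>sin (\<phi> - \<psi>)\<bar> * (?I \<phi> * ?I \<psi>) \<partial>lborel \<partial>lborel)
     = (\<integral>\<^sup>+\<phi>. (\<integral>\<^sup>+\<psi>. ennreal \<bar>sin (\<phi> - \<psi>)\<bar> * ?I \<psi> \<partial>lborel) * ?I \<phi> \<partial>lborel)"
  proof (rule nn_integral_cong)
    fix \<phi> :: real
    have "(\<integral>\<^sup>+\<psi>. ennreal \<bar>sin (\<phi> - \<psi>)\<bar> * ?I \<psi> * ?I \<phi> \<partial>lborel)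
      = (\<integral>\<^sup>+\<psi>. ennreal \<bar>sin (\<phi> - \<psi>)\<bar> * ?I \<psi> \<partial>lborel) * ?I \<phi>"
      by (rule nn_integral_multc) measurable
    then show "(\<integral>\<^sup>+\<psi>. ennreal \<bar>sin (\<phi> - \<psi>)\<bar> * (?I \<phi> * ?I \<psi>) \<partial>lborel)
      = (\<integral>\<^sup>+\<psi>. ennreal \<bar>sin (\<phi> - \<psi>)\<bar> * ?I \<psi> \<partial>lborel) * ?I \<phi>"
      by (simp only: ac_simps)
  qed
  also have "\<dots> = (\<integral>\<^sup>+\<phi>. (\<integral>\<^sup>+\<psi>\<in>{s..s+\<omega>}. ennreal \<bar>sin (\<phi> - \<psi>)\<bar> \<partial>lborel) * ?I \<phi> \<partial>lborel)"
    by (subst window) (simp_all only: abs_sin, measurable)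
  also have "\<dots> = (\<integral>\<^sup>+\<phi>\<in>{s..s+\<omega>}. (\<integral>\<^sup>+\<psi>\<in>{s..s+\<omega>}. ennreal \<bar>sin (\<phi> - \<psi>)\<bar> \<partial>lborel) \<partial>lborel)"
    by (rule window) (simp_all add: abs_sin)
  also have "\<dots> = ennreal (2 * (\<omega> - sin \<omega>))"
    using nn_integral_abs_sin_square[of s "s + \<omega>"] assms(3,4) by (simp add: algebra_simps)
  finally show ?thesis by (simp only: crossing_density_def)
qed

section \<open>Tangent vectors of curves and supporting lines\<close>

lemma tangent_vector_orthogonal:
  assumes "tangent_vector S x v" and max: "\<And>y. y \<in> S \<Longrightarrow> n \<bullet> y \<le> n \<bullet> x"
  shows "n \<bullet> v = 0"
proof -
  obtain \<gamma> e where e: "0 < e" "\<gamma> ` {-e<..<e} \<subseteq> S" "\<gamma> 0 = x" "(\<gamma> has_vector_derivative v) (at 0)"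
    using assms(1) by (auto simp: tangent_vector_def)
  have "((\<lambda>t. n \<bullet> \<gamma> t) has_vector_derivative n \<bullet> v) (at 0)"
    by (rule bounded_linear.has_vector_derivative[OF bounded_linear_inner_right e(4)])
  then have "((\<lambda>t. n \<bullet> \<gamma> t) has_real_derivative n \<bullet> v) (at 0)"
    by (simp add: has_real_derivative_iff_has_vector_derivative)
  then show ?thesis
  proof (rule DERIV_local_max[OF _ e(1)])
    show "\<forall>t. \<bar>0 - t\<bar> < e \<longrightarrow> n \<bullet> \<gamma> t \<le> n \<bullet> \<gamma> 0"
      using e(2,3) max by (auto simp: image_subset_iff abs_less_iff)
  qed
qed

lemma parallel_if_orthogonal_real2:
  fixes n v w :: "real^2"
  assumes "n \<noteq> 0" "w \<noteq> 0" "n \<bullet> v = 0" "n \<bullet> w = 0"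
  obtains c where "v = c *\<^sub>R w"
proof -
  have 1: "n$1 * v$1 + n$2 * v$2 = 0" "n$1 * w$1 + n$2 * w$2 = 0"
    using assms(3,4) by (simp_all add: inner_vec_def sum_2)
  have n: "n$1 \<noteq> 0 \<or> n$2 \<noteq> 0" using assms(1) by (simp add: vec_eq_iff forall_2)
  have "n$1 * (v$1 * w$2 - v$2 * w$1) = 0" "n$2 * (v$1 * w$2 - v$2 * w$1) = 0"
    using 1 by algebra+
  with n have 2: "v$1 * w$2 = v$2 * w$1" by auto
  have w: "w \<bullet> w \<noteq> 0" using assms(2) by simp
  have "v = ((v \<bullet> w) / (w \<bullet> w)) *\<^sub>R w"
  proof -
    have "(v \<bullet> w) * w$1 = v$1 * (w \<bullet> w)" "(v \<bullet> w) * w$2 = v$2 * (w \<bullet> w)"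
      using 2 unfolding inner_vec_def sum_2 inner_real_def by algebra+
    then show ?thesis using w unfolding vec_eq_iff forall_2 by (simp add: field_simps)
  qed
  then show ?thesis by (rule that)
qed

text \<open>The velocity of a regular curve at an extreme point of a linear functional does not vanish and
  lies along the supporting line, which in the plane determines its direction up to sign.
  Reparametrising by a constant factor produces every vector of that direction.\<close>
lemma C2_curve_tangent_vector:
  fixes S :: "(real^2) set"
  assumes "C2_curve S" "x \<in> S" "n \<noteq> 0" and max: "\<And>y. y \<in> S \<Longrightarrow> n \<bullet> y \<le> n \<bullet> x"
    and v: "n \<bullet> v = 0"
  shows "tangent_vector S x v"
proof -
  obtain U a b \<gamma> \<delta> where U: "x \<in> U" "homeomorphism {a<..<b} (S \<inter> U) \<gamma> \<delta>"
      "C2_differentiable_on \<gamma> {a<..<b}"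
      "\<And>t. t \<in> {a<..<b} \<Longrightarrow> vector_derivative \<gamma> (at t) \<noteq> 0"
    using assms(1,2) unfolding C2_curve_def by (metis (no_types, lifting))
  define t0 where "t0 = \<delta> x"
  have t0: "t0 \<in> {a<..<b}" "\<gamma> t0 = x" and img: "\<gamma> ` {a<..<b} \<subseteq> S"
    using U(1,2) assms(2) by (auto simp: homeomorphism_def t0_def)
  obtain w where w: "(\<gamma> has_vector_derivative w) (at t0)"
    using U(3) t0(1) unfolding C2_differentiable_on_def by blast
  then have "w \<noteq> 0" using U(4)[OF t0(1)] vector_derivative_at by blast
  obtain r where r: "0 < r" "{t0 - r<..<t0 + r} \<subseteq> {a<..<b}"
  proof
    show "0 < min (t0 - a) (b - t0)" using t0(1) by simp
  qed auto
  have curve: "tangent_vector S x (c *\<^sub>R w)" for c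
    unfolding tangent_vector_def
  proof (intro exI conjI)
    let ?e = "r / (\<bar>c\<bar> + 1)"
    show "0 < ?e" using r(1) by simp
    show "(\<lambda>s. \<gamma> (t0 + s * c)) ` {- ?e<..<?e} \<subseteq> S"
    proof safe
      fix s assume "s \<in> {- ?e<..<?e}"
      then have "\<bar>s\<bar> < ?e" by (auto simp: abs_less_iff)
      then have "\<bar>s\<bar> * (\<bar>c\<bar> + 1) < r" by (simp add: pos_less_divide_eq)
      then have "\<bar>s * c\<bar> < r" by (simp add: abs_mult algebra_simps)
      then have "t0 + s * c \<in> {a<..<b}" using r(2) by (auto simp: abs_less_iff subset_iff)
      then show "\<gamma> (t0 + s * c) \<in> S" using img by auto
    qed
    have "((\<lambda>s. t0 + s * c) has_vector_derivative c) (at 0)"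
      by (auto intro!: derivative_eq_intros simp flip: has_real_derivative_iff_has_vector_derivative)
    from vector_diff_chain_at[OF this, of \<gamma> w] w
    show "((\<lambda>s. \<gamma> (t0 + s * c)) has_vector_derivative c *\<^sub>R w) (at 0)"
      by (simp add: o_def)
  qed (use t0 in simp)
  have "n \<bullet> w = 0"
    using tangent_vector_orthogonal[OF curve[of 1] max] by simp
  then obtain c where "v = c *\<^sub>R w"
    using parallel_if_orthogonal_real2[OF assms(3) \<open>w \<noteq> 0\<close> v] by metis
  then show ?thesis using curve by simp
qed

section \<open>The visual angle as the range of an angular coordinate\<close>

lemma polar_decomposition_half_plane:
  fixes y :: "real^2"
  assumes "0 < y \<bullet> unit_dir \<beta>"
  shows "y = norm y *\<^sub>R unit_dir (\<beta> + arctan ((y \<bullet> unit_dir (\<beta> + pi / 2)) / (y \<bullet> unit_dir \<beta>)))"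
proof -
  define p q where "p = y \<bullet> unit_dir \<beta>" and "q = y \<bullet> unit_dir (\<beta> + pi / 2)"
  define \<theta> where "\<theta> = arctan (q / p)"
  have p: "p = y$1 * cos \<beta> + y$2 * sin \<beta>" and q: "q = - y$1 * sin \<beta> + y$2 * cos \<beta>"
    by (simp_all add: p_def q_def inner_unit_dir cos_add sin_add)
  have y: "y$1 = p * cos \<beta> - q * sin \<beta>" "y$2 = p * sin \<beta> + q * cos \<beta>"
    unfolding p q using sin_cos_squared_add[of \<beta>] by algebra+
  have "p > 0" using assms by (simp add: p_def)
  have "(norm y)\<^sup>2 = p\<^sup>2 + q\<^sup>2"
  proof -
    have "(norm y)\<^sup>2 = (y$1)\<^sup>2 + (y$2)\<^sup>2"
      by (simp add: norm_vec_def L2_set_def sum_2)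
    then show ?thesis unfolding p q using sin_cos_squared_add[of \<beta>] by algebra
  qed
  also have "\<dots> = (p * sqrt (1 + (q / p)\<^sup>2))\<^sup>2"
    using \<open>p > 0\<close> by (simp add: power_mult_distrib power_divide field_simps)
  finally have norm: "norm y = p * sqrt (1 + (q / p)\<^sup>2)"
    using \<open>p > 0\<close> by (simp add: power2_eq_iff_nonneg)
  have pos: "0 < sqrt (1 + (q / p)\<^sup>2)"
    by (simp add: add_pos_nonneg)
  have e: "norm y * cos \<theta> = p" "norm y * sin \<theta> = q"
    using \<open>p > 0\<close> pos by (auto simp: norm \<theta>_def cos_arctan sin_arctan)
  have "y$1 = norm y * cos (\<beta> + \<theta>)" "y$2 = norm y * sin (\<beta> + \<theta>)"
    unfolding cos_add sin_add y e[symmetric] by (simp_all add: algebra_simps)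
  then have "y = norm y *\<^sub>R unit_dir (\<beta> + \<theta>)"
    unfolding vec_eq_iff forall_2 by (simp add: unit_dir_def)
  then show ?thesis by (simp add: \<theta>_def p_def q_def)
qed

text \<open>Let \<open>\<beta>\<close> be the normal, pointing away from \<open>K\<close>, of a line that strictly separates \<open>P\<close> from \<open>K\<close>.
  The vectors from points of \<open>K\<close> to \<open>P\<close> deviate from \<open>\<beta>\<close> by less than a right angle, so that the angle
  is a continuous real function on \<open>K\<close> with no branch cut in the way.\<close>
lemma exterior_point_angular_coordinate:
  fixes K :: "(real^2) set"
  assumes "compact K" "convex K" "P \<notin> K"
  obtains \<beta> g where "continuous_on K g"
    and "\<And>x. x \<in> K \<Longrightarrow> P - x = norm (P - x) *\<^sub>R unit_dir (\<beta> + g x)"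
    and "\<And>x. x \<in> K \<Longrightarrow> \<bar>g x\<bar> < pi / 2"
proof -
  obtain a b where ab: "a \<bullet> P < b" "\<And>x. x \<in> K \<Longrightarrow> b < a \<bullet> x"
    using separating_hyperplane_closed_point[OF assms(2) compact_imp_closed[OF assms(1)] assms(3)] by blast
  obtain \<beta> where \<beta>: "- a = norm (- a) *\<^sub>R unit_dir \<beta>" by (rule polar_decomposition)
  have pos: "0 < (P - x) \<bullet> unit_dir \<beta>" if "x \<in> K" for x
  proof -
    have "0 < (P - x) \<bullet> (- a)" using ab(1) ab(2)[OF that] by (simp add: inner_diff inner_commute)
    also have "\<dots> = norm (- a) * ((P - x) \<bullet> unit_dir \<beta>)" by (subst \<beta>) (simp only: inner_scaleR_right)
    finally show ?thesis by (simp add: zero_less_mult_iff)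
  qed
  show ?thesis
  proof
    let ?g = "\<lambda>x. arctan (((P - x) \<bullet> unit_dir (\<beta> + pi / 2)) / ((P - x) \<bullet> unit_dir \<beta>))"
    show "continuous_on K ?g"
      by (intro continuous_intros) (use pos in force)
    show "P - x = norm (P - x) *\<^sub>R unit_dir (\<beta> + ?g x)" if "x \<in> K" for x
      by (rule polar_decomposition_half_plane[OF pos[OF that]])
    show "\<bar>?g x\<bar> < pi / 2" if "x \<in> K" for x
      by (metis abs_less_iff arctan_lbound arctan_ubound minus_less_iff)
  qed
qed

lemma interior_inner_maximum_zero:
  assumes "x \<in> interior K" "\<And>y. y \<in> K \<Longrightarrow> n \<bullet> y \<le> n \<bullet> x"
  shows "n = 0"
proof (rule ccontr)
  assume "n \<noteq> 0"
  obtain e where e: "0 < e" "cball x e \<subseteq> K" using assms(1) mem_interior_cball by blast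
  have "x + (e / norm n) *\<^sub>R n \<in> K"
    using e \<open>n \<noteq> 0\<close> by (intro subsetD[OF e(2)]) (simp add: dist_norm)
  from assms(2)[OF this] have "(e / norm n) * (n \<bullet> n) \<le> 0" by (simp add: inner_add_right)
  moreover have "0 < (e / norm n) * (n \<bullet> n)" using \<open>n \<noteq> 0\<close> e(1) by simp
  ultimately show False by linarith
qed

lemma frontier_supporting_normal:
  fixes K :: "'a::euclidean_space set"
  assumes "convex K" "interior K \<noteq> {}" "x \<in> frontier K"
  obtains n where "n \<noteq> 0" "\<And>y. y \<in> K \<Longrightarrow> n \<bullet> y \<le> n \<bullet> x"
proof -
  have "x \<in> closure K" "x \<notin> rel_interior K"
    using assms by (auto simp: frontier_def rel_interior_nonempty_interior)
  then obtain a where "a \<noteq> 0" "\<And>y. y \<in> closure K \<Longrightarrow> a \<bullet> x \<le> a \<bullet> y"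
    using supporting_hyperplane_relative_frontier[OF assms(1)] by metis
  then show ?thesis using closure_subset by (intro that[of "- a"]) auto
qed

text \<open>The angular coordinate maps \<open>K\<close> onto a compact interval \<open>[\<theta>1, \<theta>2]\<close>.  A line through \<open>P\<close> meets \<open>K\<close>
  just when its angle lies in this interval, and it supports \<open>K\<close> just when its angle is an end point;
  hence the points of tangency are those with angle \<open>\<theta>1\<close> or \<open>\<theta>2\<close>, and the visual angle is
  \<open>\<theta>2 - \<theta>1\<close>.\<close>
lemma visual_angle_and_meeting_normals:
  fixes K :: "(real^2) set"
  assumes K: "compact K" "convex K" "interior K \<noteq> {}" "C2_curve (frontier K)" and P: "P \<notin> K"
  obtains c s where "0 \<le> visual_angle K P" "visual_angle K P \<le> pi"
    "{c..<c+pi} \<inter> meeting_normals K P = {s..s + visual_angle K P}"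
proof -
  obtain \<beta> g where g: "continuous_on K g"
    and polar: "\<And>x. x \<in> K \<Longrightarrow> P - x = norm (P - x) *\<^sub>R unit_dir (\<beta> + g x)"
    and g_bound: "\<And>x. x \<in> K \<Longrightarrow> \<bar>g x\<bar> < pi / 2"
    using exterior_point_angular_coordinate[OF K(1,2) P] by metis
  have dist_pos: "0 < norm (P - x)" if "x \<in> K" for x using that P by auto
  have K_ne: "K \<noteq> {}" using K(3) interior_subset by blast
  \<comment> \<open>On which side of the line through \<open>P\<close> at angle \<open>\<tau>\<close> a point lies is decided by comparing angles.\<close>
  have side: "(y - P) \<bullet> unit_dir (\<beta> + pi / 2 + \<tau>) = norm (P - y) * sin (\<tau> - g y)" if "y \<in> K" for y \<tau>
  proof -
    have "(y - P) \<bullet> unit_dir (\<beta> + pi / 2 + \<tau>) = - ((P - y) \<bullet> unit_dir (\<beta> + pi / 2 + \<tau>))"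
      by (simp add: inner_diff_left)
    also have "\<dots> = - (norm (P - y) * (unit_dir (\<beta> + g y) \<bullet> unit_dir (\<beta> + pi / 2 + \<tau>)))"
      by (subst polar[OF that]) (simp only: inner_scaleR_left)
    also have "unit_dir (\<beta> + g y) \<bullet> unit_dir (\<beta> + pi / 2 + \<tau>) = cos (pi / 2 - (g y - \<tau>))"
      unfolding inner_unit_dir_unit_dir by (subst cos_minus[symmetric]) (simp add: algebra_simps)
    also have "\<dots> = - sin (\<tau> - g y)"
      using sin_minus[of "\<tau> - g y"] by (simp only: cos_diff) simp
    finally show ?thesis by simp
  qed
  have g_diff: "\<bar>g x - g y\<bar> < pi" if "x \<in> K" "y \<in> K" for x y
    using g_bound[OF that(1)] g_bound[OF that(2)] by linarith
  obtain \<theta>1 \<theta>2 where range: "g ` K = {\<theta>1..\<theta>2}"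
    using connected_compact_interval_1[of "g ` K"] compact_continuous_image[OF g K(1)]
      connected_continuous_image[OF g convex_connected[OF K(2)]] by blast
  then have "\<theta>1 \<le> \<theta>2" using K_ne by fastforce
  then obtain x1 x2 where x1: "x1 \<in> K" "g x1 = \<theta>1" and x2: "x2 \<in> K" "g x2 = \<theta>2"
    using range by (metis atLeastAtMost_iff imageE order_refl)
  have g_range: "\<theta>1 \<le> g y" "g y \<le> \<theta>2" if "y \<in> K" for y
    using range that by auto
  \<comment> \<open>A set seen at a single angle lies on a line and has no interior.\<close>
  have "\<theta>1 < \<theta>2"
  proof (rule ccontr)
    assume "\<not> \<theta>1 < \<theta>2"
    then have "g y = \<theta>1" if "y \<in> K" for y using g_range[OF that] by linarith
    then have flat: "(y - P) \<bullet> unit_dir (\<beta> + pi / 2 + \<theta>1) = 0" if "y \<in> K" for y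
      using side[OF that, of \<theta>1] that by simp
    obtain z where "z \<in> interior K" using K(3) by blast
    then have "unit_dir (\<beta> + pi / 2 + \<theta>1) = 0"
    proof (rule interior_inner_maximum_zero)
      fix y assume "y \<in> K"
      moreover have "z \<in> K" using \<open>z \<in> interior K\<close> interior_subset by blast
      ultimately show "unit_dir (\<beta> + pi / 2 + \<theta>1) \<bullet> y \<le> unit_dir (\<beta> + pi / 2 + \<theta>1) \<bullet> z"
        using flat[of y] flat[of z] by (simp add: inner_diff_left inner_commute)
    qed
    then show False using norm_unit_dir[of "\<beta> + pi / 2 + \<theta>1"] by simp
  qed
  \<comment> \<open>The tangent at a point of tangency is orthogonal to a supporting normal \<open>n\<close>.  So \<open>n\<close> is a multiple
    of the normal of the line from \<open>P\<close> to this point, and the whole of \<open>K\<close> lies to one side of that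
    line; the sign of the factor tells to which side.\<close>
  have extreme: "g x = \<theta>1 \<or> g x = \<theta>2" if "x \<in> tangency_points K P" for x
  proof -
    have x: "x \<in> frontier K" "tangent_vector (frontier K) x (P - x)"
      using that by (auto simp: tangency_points_def)
    have sub: "frontier K \<subseteq> K" using compact_imp_closed[OF K(1)] frontier_subset_closed by blast
    then have "x \<in> K" using x(1) by blast
    obtain n where n: "n \<noteq> 0" "\<And>y. y \<in> K \<Longrightarrow> n \<bullet> y \<le> n \<bullet> x"
      using frontier_supporting_normal[OF K(2,3) x(1)] by metis
    have n0: "n \<bullet> (P - x) = 0"
      by (rule tangent_vector_orthogonal[OF x(2)]) (use n(2) sub in blast)
    obtain c where c: "n = c *\<^sub>R unit_dir (\<beta> + pi / 2 + g x)"
    proof (rule parallel_if_orthogonal_real2[of "P - x" "unit_dir (\<beta> + pi / 2 + g x)" n])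
      show "P - x \<noteq> 0" using dist_pos[OF \<open>x \<in> K\<close>] by auto
      show "unit_dir (\<beta> + pi / 2 + g x) \<noteq> 0" by simp
      show "(P - x) \<bullet> n = 0" using n0 by (simp add: inner_commute)
      show "(P - x) \<bullet> unit_dir (\<beta> + pi / 2 + g x) = 0"
        using side[OF \<open>x \<in> K\<close>, of "g x"] by (simp add: inner_diff_left)
    qed (use that in blast)
    have le: "c * sin (g x - g y) \<le> 0" if "y \<in> K" for y
    proof -
      have "n \<bullet> (y - P) = n \<bullet> (y - x)" using n0 by (simp add: inner_diff_right)
      also have "\<dots> \<le> 0" using n(2)[OF that] by (simp add: inner_diff_right)
      also have "n \<bullet> (y - P) = norm (P - y) * (c * sin (g x - g y))"
        using side[OF that, of "g x"] by (simp add: c inner_commute)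
      finally show ?thesis using dist_pos[OF that] by (simp add: mult_le_0_iff)
    qed
    have "c \<noteq> 0" using n(1) c by auto
    then consider "c > 0" | "c < 0" by linarith
    then show ?thesis
    proof cases
      case 1
      then have "sin (g x - g x1) \<le> 0" using le[OF x1(1)] by (simp add: mult_le_0_iff)
      then have "\<not> g x1 < g x" using sin_gt_zero[of "g x - g x1"] g_diff[OF \<open>x \<in> K\<close> x1(1)] by auto
      then show ?thesis using g_range[OF \<open>x \<in> K\<close>] x1(2) by simp
    next
      case 2
      then have "0 \<le> sin (g x - g x2)" using le[OF x2(1)] by (simp add: mult_le_0_iff)
      then have "\<not> g x < g x2"
        using sin_gt_zero[of "g x2 - g x"] sin_minus[of "g x2 - g x"] g_diff[OF \<open>x \<in> K\<close> x2(1)] by auto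
      then show ?thesis using g_range[OF \<open>x \<in> K\<close>] x2(2) by simp
    qed
  qed
  \<comment> \<open>Conversely, a line through \<open>P\<close> and a point \<open>x\<close> of \<open>K\<close> that leaves \<open>K\<close> to one side, which the sign of
    \<open>\<sigma>\<close> selects, supports \<open>K\<close> at \<open>x\<close> and is therefore tangent to the boundary.\<close>
  have tangency: "x \<in> tangency_points K P"
    if "x \<in> K" and \<sigma>: "\<sigma> \<noteq> 0" "\<And>y. y \<in> K \<Longrightarrow> \<sigma> * sin (g x - g y) \<le> 0" for x \<sigma>
  proof -
    define n where "n = \<sigma> *\<^sub>R unit_dir (\<beta> + pi / 2 + g x)"
    have "n \<noteq> 0" using \<sigma>(1) norm_unit_dir[of "\<beta> + pi / 2 + g x"] by (auto simp: n_def)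
    have n: "n \<bullet> (y - P) = norm (P - y) * (\<sigma> * sin (g x - g y))" if "y \<in> K" for y
      using side[OF that, of "g x"] by (simp add: n_def inner_commute)
    have n0: "n \<bullet> (P - x) = 0" using n[OF \<open>x \<in> K\<close>] by (simp add: inner_diff_right)
    have max: "n \<bullet> y \<le> n \<bullet> x" if "y \<in> K" for y
    proof -
      have "n \<bullet> (y - P) \<le> 0"
        unfolding n[OF that] using \<sigma>(2)[OF that] by (simp add: mult_nonneg_nonpos)
      then show ?thesis using n0 by (simp add: inner_diff_right)
    qed
    have "x \<in> frontier K"
      using \<open>x \<in> K\<close> closure_subset interior_inner_maximum_zero[of x K n] max \<open>n \<noteq> 0\<close>
      by (auto simp: frontier_def)
    moreover have "tangent_vector (frontier K) x (P - x)"
    proof (rule C2_curve_tangent_vector[OF K(4) \<open>x \<in> frontier K\<close> \<open>n \<noteq> 0\<close> _ n0])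
      show "n \<bullet> y \<le> n \<bullet> x" if "y \<in> frontier K" for y
        using that max frontier_subset_closed[OF compact_imp_closed[OF K(1)]] by blast
    qed
    ultimately show ?thesis by (simp add: tangency_points_def)
  qed
  have t1: "x1 \<in> tangency_points K P"
  proof (rule tangency[OF x1(1), of 1])
    fix y assume "y \<in> K"
    then show "1 * sin (g x1 - g y) \<le> 0"
      using sin_ge_zero[of "g y - g x1"] sin_minus[of "g y - g x1"] g_diff[OF \<open>y \<in> K\<close> x1(1)]
        g_range[OF \<open>y \<in> K\<close>] x1(2) by auto
  qed simp
  have t2: "x2 \<in> tangency_points K P"
  proof (rule tangency[OF x2(1), of "- 1"])
    fix y assume "y \<in> K"
    then show "- 1 * sin (g x2 - g y) \<le> 0"
      using sin_ge_zero[of "g x2 - g y"] g_diff[OF x2(1) \<open>y \<in> K\<close>] g_range[OF \<open>y \<in> K\<close>] x2(2) by auto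
  qed simp
  have tK: "x \<in> K" if "x \<in> tangency_points K P" for x
    using that frontier_subset_closed[OF compact_imp_closed[OF K(1)]] by (auto simp: tangency_points_def)
  have angle: "angle_between (x - P) (y - P) = \<bar>g x - g y\<bar>" if "x \<in> K" "y \<in> K" for x y
  proof -
    have "(x - P) \<bullet> (y - P) = (P - x) \<bullet> (P - y)"
      by (simp add: inner_diff_left inner_diff_right)
    also have "\<dots> = norm (P - x) * norm (P - y) * cos (g x - g y)"
      by (subst polar[OF that(1)], subst polar[OF that(2)])
         (simp add: inner_unit_dir_unit_dir del: scaleR_cancel_left)
    finally have "((x - P) \<bullet> (y - P)) / (norm (x - P) * norm (y - P)) = cos (g x - g y)"
      using dist_pos[OF that(1)] dist_pos[OF that(2)] by (simp add: norm_minus_commute)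
    then show ?thesis
      using g_diff[OF that] by (simp add: angle_between_def arccos_cos_eq_abs)
  qed
  have col: "collinear {P, x, y} \<longleftrightarrow> (\<exists>c. y - P = c *\<^sub>R (x - P))" if "x \<in> K" "y \<in> K" for x y
  proof -
    have "{P, x, y} = {x, P, y}" by auto
    then have "collinear {P, x, y} \<longleftrightarrow> collinear {0, x - P, y - P}"
      by (simp add: collinear_3[of x P y])
    then show ?thesis using dist_pos[OF that(1)] dist_pos[OF that(2)] by (auto simp: collinear_lemma)
  qed
  have col_same: "collinear {P, x, y}" if "x \<in> K" "y \<in> K" "g x = g y" for x y
  proof -
    have "y - P = (norm (P - y) / norm (P - x)) *\<^sub>R (x - P)"
    proof -
      have "P - y = (norm (P - y) / norm (P - x)) *\<^sub>R (norm (P - x) *\<^sub>R unit_dir (\<beta> + g x))"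
        using polar[OF that(2)] dist_pos[OF that(1)] that(3) by simp
      also have "\<dots> = (norm (P - y) / norm (P - x)) *\<^sub>R (P - x)"
        using polar[OF that(1)] by simp
      finally show ?thesis by (metis minus_diff_eq scaleR_minus_right)
    qed
    then show ?thesis using col[OF that(1,2)] by blast
  qed
  have ncol: "\<not> collinear {P, x1, x2}"
  proof
    assume "collinear {P, x1, x2}"
    then obtain c where "x2 - P = c *\<^sub>R (x1 - P)" using col[OF x1(1) x2(1)] by blast
    then have "(x2 - P) \<bullet> unit_dir (\<beta> + pi / 2 + \<theta>1) = c * ((x1 - P) \<bullet> unit_dir (\<beta> + pi / 2 + \<theta>1))"
      by simp
    then have "sin (\<theta>1 - \<theta>2) = 0"
      unfolding side[OF x1(1)] side[OF x2(1)] using dist_pos[OF x2(1)] x1(2) x2(2) by simp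
    then show False
      using sin_eq_0_pi[of "\<theta>1 - \<theta>2"] g_diff[OF x1(1) x2(1)] \<open>\<theta>1 < \<theta>2\<close> x1(2) x2(2) by auto
  qed
  have \<omega>: "visual_angle K P = \<theta>2 - \<theta>1"
    unfolding visual_angle_def
  proof (rule the_equality)
    show "\<exists>x\<in>tangency_points K P. \<exists>y\<in>tangency_points K P.
        \<not> collinear {P, x, y} \<and> \<theta>2 - \<theta>1 = angle_between (x - P) (y - P)"
      using t1 t2 ncol angle[OF x1(1) x2(1)] x1(2) x2(2) \<open>\<theta>1 < \<theta>2\<close> by (intro bexI[of _ x1] bexI[of _ x2]) auto
    fix \<omega> assume "\<exists>x\<in>tangency_points K P. \<exists>y\<in>tangency_points K P.
        \<not> collinear {P, x, y} \<and> \<omega> = angle_between (x - P) (y - P)"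
    then obtain x y where xy: "x \<in> tangency_points K P" "y \<in> tangency_points K P"
      "\<not> collinear {P, x, y}" "\<omega> = angle_between (x - P) (y - P)" by blast
    then have "g x \<noteq> g y" using col_same tK by blast
    then show "\<omega> = \<theta>2 - \<theta>1"
      using extreme[OF xy(1)] extreme[OF xy(2)] xy(4) angle[OF tK tK, OF xy(1,2)] \<open>\<theta>1 < \<theta>2\<close> by auto
  qed
  \<comment> \<open>The window that starts at \<open>\<beta>\<close> puts the angles of lines through \<open>P\<close> into \<open>[- pi / 2, pi / 2)\<close>, which
    covers the range of the angular coordinate, so that the arc is not cut.\<close>
  have "{\<beta>..<\<beta>+pi} \<inter> meeting_normals K P = {\<beta> + pi / 2 + \<theta>1..\<beta> + pi / 2 + \<theta>1 + (\<theta>2 - \<theta>1)}"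
  proof -
    have "\<phi> \<in> meeting_normals K P \<longleftrightarrow> \<phi> - (\<beta> + pi / 2) \<in> g ` K" if "\<phi> \<in> {\<beta>..<\<beta>+pi}" for \<phi>
    proof -
      define \<tau> where "\<tau> = \<phi> - (\<beta> + pi / 2)"
      have "x \<bullet> unit_dir \<phi> = P \<bullet> unit_dir \<phi> \<longleftrightarrow> \<tau> = g x" if "x \<in> K" for x
      proof -
        have "x \<bullet> unit_dir \<phi> = P \<bullet> unit_dir \<phi> \<longleftrightarrow> (x - P) \<bullet> unit_dir (\<beta> + pi / 2 + \<tau>) = 0"
          by (simp add: \<tau>_def inner_diff_left)
        also have "\<dots> \<longleftrightarrow> sin (\<tau> - g x) = 0"
          unfolding side[OF that] using dist_pos[OF that] by simp
        also have "\<dots> \<longleftrightarrow> \<tau> = g x"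
          using sin_eq_0_pi[of "\<tau> - g x"] g_bound[OF that] \<open>\<phi> \<in> {\<beta>..<\<beta>+pi}\<close> by (auto simp: \<tau>_def)
        finally show ?thesis .
      qed
      then show ?thesis unfolding meeting_normals_def \<tau>_def by blast
    qed
    moreover have "\<phi> \<in> {\<beta>..<\<beta>+pi}" if "\<phi> - (\<beta> + pi / 2) \<in> g ` K" for \<phi>
      using that g_bound by (force simp: abs_less_iff)
    ultimately have "{\<beta>..<\<beta>+pi} \<inter> meeting_normals K P = {\<phi>. \<phi> - (\<beta> + pi / 2) \<in> {\<theta>1..\<theta>2}}"
      unfolding range[symmetric] by blast
    also have "\<dots> = {\<beta> + pi / 2 + \<theta>1..\<beta> + pi / 2 + \<theta>1 + (\<theta>2 - \<theta>1)}"
      unfolding set_eq_iff mem_Collect_eq atLeastAtMost_iff by (intro allI) argo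
    finally show ?thesis .
  qed
  moreover have "\<theta>2 - \<theta>1 \<le> pi" using g_diff[OF x1(1) x2(1)] x1(2) x2(2) by linarith
  ultimately show ?thesis
    using that[of \<beta> "\<beta> + pi / 2 + \<theta>1"] \<open>\<theta>1 < \<theta>2\<close> unfolding \<omega> by simp
qed

section \<open>Crofton's formula\<close>

theorem proposition6:
  fixes K :: "(real^2) set" and F :: real
  assumes "compact K" and "convex K"
    and "C2_curve (frontier K)"
    and "0 \<in> interior K"
    and "F = measure lborel K"
  shows "set_integrable lborel {(G1, G2). G1 \<in> lines_meeting K \<and> G2 \<in> lines_meeting K} (\<lambda>_. 1::real) \<and>
    set_integrable lborel (- K) (\<lambda>P. visual_angle K P - sin (visual_angle K P)) \<and>
    (LINT G:{(G1, G2). G1 \<in> lines_meeting K \<and> G2 \<in> lines_meeting K}|lborel. (1::real)) =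
      2 * pi * F + 2 * (LINT P:- K|lborel. visual_angle K P - sin (visual_angle K P))"
proof -
  define L where "L = lines_meeting K"
  define E where "E = emeasure lborel L"
  define w where "w P = indicator (- K) P *\<^sub>R (visual_angle K P - sin (visual_angle K P))" for P
  have "0 \<in> K" using assms(4) interior_subset by blast
  have K_borel [measurable]: "K \<in> sets borel"
    using compact_imp_closed[OF assms(1)] by (rule borel_closed)
  note crossing_density_measurable[OF assms(1), measurable]

  have inside: "crossing_density K P = ennreal (2 * pi)" if "P \<in> K" "P \<noteq> 0" for P
  proof -
    have "meeting_normals K P = UNIV" using \<open>P \<in> K\<close> by (auto simp: meeting_normals_def)
    then have "crossing_density K P = ennreal (2 * (pi - sin pi))"
      by (intro crossing_density_eq[OF assms(1) \<open>P \<noteq> 0\<close>, of pi 0 0]) auto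
    then show ?thesis by simp
  qed
  have outside: "crossing_density K P = ennreal (2 * (visual_angle K P - sin (visual_angle K P)))"
    and angle_nonneg: "0 \<le> visual_angle K P" if P: "P \<notin> K" for P
  proof -
    have "interior K \<noteq> {}" "P \<noteq> 0" using assms(4) \<open>0 \<in> K\<close> that by auto
    then obtain c s where \<omega>: "0 \<le> visual_angle K P" "visual_angle K P \<le> pi"
        and M: "{c..<c+pi} \<inter> meeting_normals K P = {s..s + visual_angle K P}"
      using visual_angle_and_meeting_normals[OF assms(1,2) _ assms(3) P] by metis
    show "crossing_density K P = ennreal (2 * (visual_angle K P - sin (visual_angle K P)))"
      by (rule crossing_density_eq[OF assms(1) \<open>P \<noteq> 0\<close> \<omega>, of c s]) (unfold M, auto)
    show "0 \<le> visual_angle K P" by fact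
  qed
  have w_nonneg: "0 \<le> w P" for P
    using angle_nonneg[of P] sin_x_le_x[of "visual_angle K P"] by (auto simp: w_def indicator_def)
  have w_eq: "ennreal (2 * w P) = crossing_density K P * indicator (- K) P" for P
    using outside[of P] by (auto simp: w_def indicator_def)
  \<comment> \<open>The visual angle is a definite description; its measurability comes from the density.\<close>
  have [measurable]: "w \<in> borel_measurable borel"
  proof -
    have "w P = enn2real (crossing_density K P * indicator (- K) P) / 2" for P
      using w_nonneg[of P] by (simp flip: w_eq)
    then have "w = (\<lambda>P. enn2real (crossing_density K P * indicator (- K) P) / 2)" by blast
    also have "\<dots> \<in> borel_measurable borel" by measurable
    finally show ?thesis .
  qed

  have "emeasure lborel K < \<infinity>"
    using compact_imp_bounded[OF assms(1)] by (rule emeasure_bounded_finite)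
  then have K_area: "emeasure lborel K = ennreal F"
    unfolding assms(5) by (intro emeasure_eq_ennreal_measure) auto
  have "0 \<le> F" by (simp add: assms(5))
  have "E * E = (\<integral>\<^sup>+P. crossing_density K P \<partial>lborel)"
    unfolding E_def L_def by (rule emeasure_lines_meeting_square[OF assms(1)])
  also have "\<dots> = (\<integral>\<^sup>+P. ennreal (2 * pi) * indicator K P + ennreal (2 * w P) \<partial>lborel)"
  proof (rule nn_integral_cong_AE)
    have "AE P in lborel. P \<noteq> (0 :: real^2)" by (rule AE_lborel_singleton)
    then show "AE P in lborel. crossing_density K P = ennreal (2 * pi) * indicator K P + ennreal (2 * w P)"
    proof eventually_elim
      case (elim P)
      then show ?case unfolding w_eq by (cases "P \<in> K") (simp_all add: inside)
    qed
  qed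
  also have "\<dots> = (\<integral>\<^sup>+P. ennreal (2 * pi) * indicator K P \<partial>lborel) + (\<integral>\<^sup>+P. ennreal (2 * w P) \<partial>lborel)"
    by (rule nn_integral_add) auto
  also have "(\<integral>\<^sup>+P. ennreal (2 * pi) * indicator K P \<partial>lborel) = ennreal (2 * pi * F)"
    using \<open>0 \<le> F\<close> by (simp add: nn_integral_cmult_indicator K_area ennreal_mult)
  finally have E2: "E * E = ennreal (2 * pi * F) + (\<integral>\<^sup>+P. ennreal (2 * w P) \<partial>lborel)" .
  have "E < \<infinity>" unfolding E_def L_def by (rule emeasure_lines_meeting_finite[OF assms(1)])
  then have E_fin: "E * E < \<infinity>" by (simp add: ennreal_mult_less_top)
  then have "(\<integral>\<^sup>+P. ennreal (2 * w P) \<partial>lborel) < \<infinity>" unfolding E2 by simp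
  then have int2: "integrable lborel (\<lambda>P. 2 * w P)"
    using w_nonneg by (intro integrableI_nonneg) auto
  then have int: "integrable lborel w" by simp
  have "E * E = ennreal (2 * pi * F) + ennreal (2 * (\<integral>P. w P \<partial>lborel))"
    unfolding E2 using nn_integral_eq_integral[OF int2] w_nonneg by simp
  also have "\<dots> = ennreal (2 * pi * F + 2 * (\<integral>P. w P \<partial>lborel))"
    using \<open>0 \<le> F\<close> w_nonneg by (intro ennreal_plus[symmetric]) (auto intro!: integral_nonneg_AE)
  finally have E_eq: "E * E = \<dots>" .

  have LL: "{(G1, G2). G1 \<in> L \<and> G2 \<in> L} = L \<times> L" by auto
  have L_borel: "L \<in> sets borel" unfolding L_def by (rule lines_meeting_borel[OF assms(1)])
  then have LL_borel: "L \<times> L \<in> sets borel" by (rule borel_Times) (rule L_borel)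
  have LL_measure: "emeasure lborel (L \<times> L) = E * E"
  proof -
    have "emeasure (lborel \<Otimes>\<^sub>M lborel) (L \<times> L) = E * E"
      unfolding E_def using L_borel by (intro lborel.emeasure_pair_measure_Times) auto
    then show ?thesis by (simp only: lborel_prod)
  qed
  have "set_integrable lborel (L \<times> L) (\<lambda>_. 1::real)"
    unfolding set_integrable_def using LL_borel E_fin LL_measure by simp
  moreover have "(LINT G:L \<times> L|lborel. (1::real)) = 2 * pi * F + 2 * (\<integral>P. w P \<partial>lborel)"
  proof -
    have "(LINT G:L \<times> L|lborel. (1::real)) = measure lborel (L \<times> L)"
      unfolding set_lebesgue_integral_def using LL_borel by simp
    also have "\<dots> = 2 * pi * F + 2 * (\<integral>P. w P \<partial>lborel)"
      unfolding measure_def LL_measure E_eq using \<open>0 \<le> F\<close> w_nonneg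
      by (intro enn2real_ennreal add_nonneg_nonneg) (auto intro!: integral_nonneg_AE)
    finally show ?thesis .
  qed
  moreover have "set_integrable lborel (- K) (\<lambda>P. visual_angle K P - sin (visual_angle K P))"
    using int unfolding set_integrable_def w_def .
  moreover have "(LINT P:- K|lborel. visual_angle K P - sin (visual_angle K P)) = (\<integral>P. w P \<partial>lborel)"
    unfolding set_lebesgue_integral_def w_def ..
  ultimately show ?thesis unfolding L_def[symmetric] LL by simp
qed

end
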